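(* Let $\mathcal{G}$ be the standard Borel space of countably infinite groups, and let $\mathcal{G}_{Hop}=\{G\in\mathcal{G} : G \text{ is Hopfian}\}$. Then $\mathcal{G}_{Hop}$ is a $\Pi^1_1$-complete (i.e. complete co-analytic) subset of $\mathcal{G}$.
   Context: A group $G$ is Hopfian if every surjective group homomorphism from $G$ to $G$ is an isomorphism. The standard Borel space $\mathcal{G}$ of countably infinite groups is the set of all binary operations $m\colon\omega\times\omega\to\omega$ that make $\omega$ into a group. It is a Borel subset of the Polish space $\omega^{\omega\times\omega}$ (with the product topology, $\omega$ discrete), and it carries the induced Borel structure. An element of $\mathcal{G}$ is identified with the group it determines. A subset $A$ of a standard Borel space $X$ is $\Pi^1_1$-complete (complete co-analytic) if $A$ is co-analytic (that is, $\Pi^1_1$ in the boldface sense) and, for every standard Borel space $Y$ and every co-analytic $B\subseteq Y$, there is a Borel map $f\colon Y\to X$ with $f^{-1}(A)=B$. *)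

theory Defs
  imports "HOL-Analysis.Analysis" "HOL-Algebra.Group"
begin

section \<open>Standard Borel spaces and co-analytic sets\<close>

text \<open>Measurable spaces are represented by the type of measures; only \<^const>\<open>space\<close> and
  \<^const>\<open>sets\<close> matter here, never the measure itself.\<close>

definition standard_borel :: "'a measure \<Rightarrow> bool" where
  "standard_borel M \<longleftrightarrow>
     (\<exists>T. completely_metrizable_space T \<and> second_countable T \<and> topspace T = space M \<and>
          sets M = sigma_sets (space M) {U. openin T U})"

text \<open>Boldface \<open>\<Sigma>\<^sup>1\<^sub>1\<close>: projections along the Baire space of Borel sets.\<close>

definition analytic_set :: "'a measure \<Rightarrow> 'a set \<Rightarrow> bool" where
  "analytic_set M A \<longleftrightarrow>
     (\<exists>B \<in> sets (M \<Otimes>\<^sub>M (borel :: (nat \<Rightarrow> nat) measure)). A = fst ` B)"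

definition coanalytic_set :: "'a measure \<Rightarrow> 'a set \<Rightarrow> bool" where
  "coanalytic_set M A \<longleftrightarrow> A \<subseteq> space M \<and> analytic_set M (space M - A)"

text \<open>HOL cannot quantify over types inside a formula, so the type carrying the test spaces
  \<open>Y\<close> is a parameter. A theorem in which it is a type variable covers all standard Borel
  spaces.\<close>

definition coanalytic_complete :: "'b itself \<Rightarrow> 'a measure \<Rightarrow> 'a set \<Rightarrow> bool" where
  "coanalytic_complete (_ :: 'b itself) X A \<longleftrightarrow>
     standard_borel X \<and> coanalytic_set X A \<and>
     (\<forall>(Y :: 'b measure) B. standard_borel Y \<longrightarrow> coanalytic_set Y B \<longrightarrow>
        (\<exists>f \<in> measurable Y X. f -` A \<inter> space Y = B))"


section \<open>Hopfian groups\<close>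

definition hopfian :: "('a, 'm) monoid_scheme \<Rightarrow> bool" where
  "hopfian G \<longleftrightarrow> group G \<and> (\<forall>h \<in> epi G G. h \<in> iso G G)"


section \<open>The space of countably infinite groups\<close>

text \<open>If no identity element exists, the value of \<open>one\<close> is unspecified, but then the
  structure is not a group for any choice of \<open>one\<close>.\<close>

definition op_monoid :: "(nat \<times> nat \<Rightarrow> nat) \<Rightarrow> nat monoid" where
  "op_monoid m =
     \<lparr>carrier = UNIV, mult = (\<lambda>x y. m (x, y)), one = (THE e. \<forall>x. m (e, x) = x \<and> m (x, e) = x)\<rparr>"

definition group_space :: "(nat \<times> nat \<Rightarrow> nat) measure" where
  "group_space = restrict_space borel {m. group (op_monoid m)}"

definition hopfian_groups :: "(nat \<times> nat \<Rightarrow> nat) set" where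
  "hopfian_groups = {m \<in> space group_space. hopfian (op_monoid m)}"

lemma op_monoid_eq:
  assumes "group \<lparr>carrier = UNIV, mult = (\<lambda>x y. m (x, y)), one = e\<rparr>" (is "group ?G")
  shows "op_monoid m = ?G"
proof -
  interpret group ?G by fact
  have "(THE e. \<forall>x. m (e, x) = x \<and> m (x, e) = x) = e"
    using l_one r_one by (intro the_equality) (auto, metis)
  then show ?thesis by (simp add: op_monoid_def)
qed

lemma group_op_iff:
  "group (op_monoid m) \<longleftrightarrow>
   (\<forall>x y z. m (m (x, y), z) = m (x, m (y, z))) \<and> (\<forall>a b. \<exists>x y. m (a, x) = b \<and> m (y, a) = b)"
   (is "_ \<longleftrightarrow> ?A \<and> ?D")
proof
  assume "group (op_monoid m)"
  then interpret group "op_monoid m" .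
  have A: ?A using m_assoc by (auto simp: op_monoid_def)
  have "\<exists>x y. m (a, x) = b \<and> m (y, a) = b" for a b
  proof (intro exI conjI)
    show "m (a, m (inv\<^bsub>op_monoid m\<^esub> a, b)) = b"
      using inv_solve_left[of "m (inv\<^bsub>op_monoid m\<^esub> a, b)" a b] by (simp add: op_monoid_def)
    show "m (m (b, inv\<^bsub>op_monoid m\<^esub> a), a) = b"
      using inv_solve_right[of "m (b, inv\<^bsub>op_monoid m\<^esub> a)" b a] by (simp add: op_monoid_def)
  qed
  with A show "?A \<and> ?D" by blast
next
  assume *: "?A \<and> ?D"
  then obtain l r where l: "m (l, 0) = 0" and r: "m (0, r) = 0" by blast
  have 1: "m (l, x) = x" for x
  proof -
    obtain y where y: "m (0, y) = x" using * by blast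
    have "m (m (l, 0), y) = m (l, m (0, y))" using * by blast
    then show ?thesis by (simp add: l y)
  qed
  have 2: "m (x, r) = x" for x
  proof -
    obtain y where y: "m (y, 0) = x" using * by blast
    have "m (m (y, 0), r) = m (y, m (0, r))" using * by blast
    then show ?thesis by (simp add: r y)
  qed
  have "l = r" using 1[of r] 2[of l] by simp
  have "group \<lparr>carrier = UNIV, mult = (\<lambda>x y. m (x, y)), one = l\<rparr>"
  proof (rule groupI, goal_cases)
    case (5 x)
    have "\<exists>y. m (y, x) = l" using * by blast
    then show ?case by simp
  qed (use * 1 in simp_all)
  then show "group (op_monoid m)" using op_monoid_eq by metis
qed

lemma standard_borel_group_space: "standard_borel group_space"
proof -
  let ?E = "euclidean :: (nat \<times> nat \<Rightarrow> nat) topology"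
  let ?S = "{m. group (op_monoid m)}"
  let ?T = "subtopology ?E ?S"
  have cont: "continuous_on UNIV (\<lambda>m::nat \<times> nat \<Rightarrow> nat. m p)" for p by (rule continuous_on_product_coordinates)
  have op: "open {m::nat \<times> nat \<Rightarrow> nat. m p = b}" for p b
    using open_vimage[OF open_discrete[of "{b}"] cont[of p]] by (simp add: vimage_def)
  have e: "?S = (\<Inter>(x,y,z). \<Union>u v w. {m. m (x,y) = u} \<inter> {m. m (y,z) = v} \<inter> {m. m (u,z) = w} \<inter> {m. m (x,v) = w})
     \<inter> (\<Inter>(a,b). \<Union>x y. {m. m (a,x) = b} \<inter> {m. m (y,a) = b})"
    unfolding group_op_iff by (auto simp: set_eq_iff)
  have o1: "gdelta_in ?E (\<Inter>(x,y,z). \<Union>u v w. {m::nat \<times> nat \<Rightarrow> nat. m (x,y) = u} \<inter> {m. m (y,z) = v} \<inter> {m. m (u,z) = w} \<inter> {m. m (x,v) = w})"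
    by (intro gdelta_in_Inter) (auto intro!: open_imp_gdelta_in op open_Int open_UN simp del: UN_simps)
  have o2: "gdelta_in ?E (\<Inter>(a,b). \<Union>x y. {m::nat \<times> nat \<Rightarrow> nat. m (a,x) = b} \<inter> {m. m (y,a) = b})"
    by (intro gdelta_in_Inter) (auto intro!: open_imp_gdelta_in op open_Int open_UN simp del: UN_simps)
  have "gdelta_in ?E ?S" unfolding e by (intro gdelta_in_Int o1 o2)
  have "euclidean = (discrete_topology UNIV :: nat topology)"
    by (simp add: topology_eq open_discrete)
  moreover have "?E = product_topology (\<lambda>_. euclidean) UNIV"
    by (simp add: euclidean_product_topology)
  ultimately have "completely_metrizable_space ?E"
    by (simp add: completely_metrizable_space_product_topology completely_metrizable_space_discrete_topology)
  then have cm: "completely_metrizable_space ?T"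
    using \<open>gdelta_in ?E ?S\<close> completely_metrizable_space_gdelta_in by blast
  obtain B :: "(nat \<times> nat \<Rightarrow> nat) set set" where "countable B" "topological_basis B"
    using ex_countable_basis by blast
  then have "second_countable ?E"
    unfolding second_countable_def
    using topological_basis_open[of B] topological_basisE[of B]
    by (intro exI[of _ B]) (metis open_openin)
  then have sc: "second_countable ?T" by (rule second_countable_subtopology)
  have "sets group_space = sigma_sets ?S {U. openin ?T U}"
    using sigma_sets_vimage_commute[of "\<lambda>x. x" ?S UNIV "Collect open"]
    unfolding group_space_def sets_restrict_space borel_def openin_subtopology
    by (simp add: sets_measure_of_conv image_def Int_commute Bex_def conj_commute)
  then show ?thesis unfolding standard_borel_def
    using cm sc by (intro exI[of _ ?T]) (auto simp: group_space_def space_restrict_space)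
qed

end

theory Submission
  imports Defs "HOL-Computational_Algebra.Primes" "HOL-Library.Sublist"
begin

text \<open>A group fails to be Hopfian when some surjective endomorphism of it is not injective. On the
  underlying set \<open>\<nat>\<close> such an endomorphism is a point of the Baire space, and being one is a Borel
  condition, so the Hopfian groups form a co-analytic set (\<open>coanalytic_hopfian_groups\<close>).

  For hardness, an analytic subset of any measurable space is the set of points \<open>y\<close> at which a
  tree \<open>T y\<close> on \<open>\<nat>\<close>, depending on \<open>y\<close> in a Borel way, has an infinite branch
  (\<open>analytic_set_tree\<close>). It remains to turn a tree into a countably infinite group which is Hopfian
  exactly if the tree has no infinite branch. Abelian groups suffice.

  Give every node \<open>u\<close> its own prime \<open>p\<^sub>u\<close>, and let \<open>R\<^sub>s\<close> be the ring of all fractions whose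
  denominators are divisible by no \<open>p\<^sub>u\<close> with \<open>u\<close> an initial segment of \<open>s\<close>. The group of
  a tree is the direct sum of the \<open>R\<^sub>s\<close> over its nodes \<open>s\<close>. If \<open>t\<close> is not an initial
  segment of \<open>s\<close>, then \<open>R\<^sub>s\<close> is divisible by all powers of \<open>p\<^sub>t\<close>, whereas no nonzero
  element of \<open>R\<^sub>t\<close> is; hence an endomorphism can move the summand of \<open>s\<close> only towards the
  root (\<open>vanishes_outside_cone\<close>). Endomorphisms are therefore triangular, and their diagonal entries are
  zero or injective. A non-injective endomorphism has a zero diagonal entry, and if the
  endomorphism is onto, a zero entry at \<open>t\<close> forces another one at a proper extension of \<open>t\<close>
  (\<open>zero_diagonal_extends\<close>). Iterating this gives a branch.

  Conversely a branch should provide a surjective shift towards the root that kills the root. The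
  inclusion of \<open>R\<^sub>s\<close> for a child \<open>s\<close> into the ring of its parent is not onto, but the rings of
  two different children together generate the ring of the parent, by Bezout
  (\<open>node_ring_split\<close>). So every edge of the tree is first doubled: a branch
  becomes a full binary subtree, and adding up the two children of each node in this subtree
  is surjective, with the summand of the root in its kernel (\<open>not_hopfian_if_branch\<close>).\<close>

section \<open>Analytic sets and trees\<close>

text \<open>A set of this form is a projection along the variable \<open>z\<close>. Splitting the clauses into
  measurable conditions on \<open>y\<close> and closed conditions on \<open>(x, z)\<close> means that countable
  intersections and unions below need nothing but continuous changes of the variable \<open>z\<close>.\<close>
definition souslin_scheme ::
    "'a measure \<Rightarrow> (nat \<Rightarrow> 'a set) \<Rightarrow> (nat \<Rightarrow> ((nat \<Rightarrow> nat) \<times> (nat \<Rightarrow> nat)) set) \<Rightarrow>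
     ('a \<times> (nat \<Rightarrow> nat)) set \<Rightarrow> bool" where
  "souslin_scheme M A U B \<longleftrightarrow> (\<forall>k. A k \<in> sets M) \<and> (\<forall>k. closed (U k)) \<and>
     B = {(y, x). y \<in> space M \<and> (\<exists>z. \<forall>k. y \<in> A k \<or> (x, z) \<in> U k)}"

definition souslin :: "'a measure \<Rightarrow> ('a \<times> (nat \<Rightarrow> nat)) set \<Rightarrow> bool" where
  "souslin M B \<longleftrightarrow> (\<exists>A U. souslin_scheme M A U B)"

lemma souslinI:
  fixes U :: "nat \<Rightarrow> ((nat \<Rightarrow> nat) \<times> (nat \<Rightarrow> nat)) set"
  assumes "\<And>k. A k \<in> sets M" "\<And>k. closed (U k)"
    and "B = {(y, x). y \<in> space M \<and> (\<exists>z. \<forall>k. y \<in> A k \<or> (x, z) \<in> U k)}"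
  shows "souslin M B"
  unfolding souslin_def souslin_scheme_def using assms by (intro exI[of _ A] exI[of _ U] conjI allI)

lemma souslin_rectangle:
  assumes "A \<in> sets M" "closed (C :: (nat \<Rightarrow> nat) set)"
  shows "souslin M (A \<times> UNIV)" "souslin M (space M \<times> C)"
proof -
  show "souslin M (A \<times> UNIV)"
    by (rule souslinI[where A = "\<lambda>_. A" and U = "\<lambda>_. {}"])
      (use assms sets.sets_into_space in auto)
  show "souslin M (space M \<times> C)"
    by (rule souslinI[where A = "\<lambda>_. {}" and U = "\<lambda>_. C \<times> UNIV"])
      (use assms in \<open>auto intro: closed_Times\<close>)
qed

lemma continuous_on_Baire_reindex:
  "continuous_on UNIV (\<lambda>p :: (nat \<Rightarrow> nat) \<times> (nat \<Rightarrow> nat). (fst p, \<lambda>j. snd p (h j)))"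
proof -
  have "continuous_on UNIV (\<lambda>p :: (nat \<Rightarrow> nat) \<times> (nat \<Rightarrow> nat). (\<lambda>j. snd p (h j)))"
  proof (rule continuous_on_coordinatewise_then_product)
    show "continuous_on UNIV (\<lambda>p :: (nat \<Rightarrow> nat) \<times> (nat \<Rightarrow> nat). snd p (h j))" for j
      by (rule continuous_on_product_then_coordinatewise[OF continuous_on_snd[OF continuous_on_id]])
  qed
  then show ?thesis by (rule continuous_on_Pair[OF continuous_on_fst[OF continuous_on_id]])
qed

lemma souslin_choice:
  assumes "\<And>i::nat. souslin M (B i)"
  obtains A :: "nat \<Rightarrow> nat \<Rightarrow> 'a set" and U :: "nat \<Rightarrow> nat \<Rightarrow> ((nat \<Rightarrow> nat) \<times> (nat \<Rightarrow> nat)) set"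
  where "\<And>i k. A i k \<in> sets M" "\<And>i k. closed (U i k)"
    "\<And>i. B i = {(y, x). y \<in> space M \<and> (\<exists>z. \<forall>k. y \<in> A i k \<or> (x, z) \<in> U i k)}"
proof -
  obtain A U where "\<And>i. souslin_scheme M (A i) (U i) (B i)"
    using assms unfolding souslin_def by metis
  then show thesis by (intro that) (auto simp only: souslin_scheme_def)
qed

text \<open>The first entry of the witness names the set of the union that is to be entered; clauses
  belonging to other indices are made vacuous by the clopen condition on this entry.\<close>
lemma souslin_UN:
  assumes "\<And>i::nat. souslin M (B i)"
  shows "souslin M (\<Union>i. B i)"
proof -
  obtain A and U :: "nat \<Rightarrow> nat \<Rightarrow> ((nat \<Rightarrow> nat) \<times> (nat \<Rightarrow> nat)) set"
    where A: "\<And>i k. A i k \<in> sets M" and U: "\<And>i k. closed (U i k)"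
    and B: "\<And>i. B i = {(y, x). y \<in> space M \<and> (\<exists>z. \<forall>k. y \<in> A i k \<or> (x, z) \<in> U i k)}"
    by (rule souslin_choice[of M B, OF assms]) (rule that)
  let ?A = "\<lambda>m. A (fst (prod_decode m)) (snd (prod_decode m))"
  let ?U = "\<lambda>m. {p. snd p 0 \<noteq> fst (prod_decode m)} \<union>
     (\<lambda>p. (fst p, \<lambda>j. snd p (Suc j))) -` U (fst (prod_decode m)) (snd (prod_decode m))"
  show ?thesis
  proof (rule souslinI[of ?A _ ?U])
    show "closed (?U m)" for m
    proof (rule closed_Un)
      have "continuous_on UNIV (\<lambda>p :: (nat \<Rightarrow> nat) \<times> (nat \<Rightarrow> nat). snd p 0)"
        by (rule continuous_on_product_then_coordinatewise[OF continuous_on_snd[OF continuous_on_id]])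
      then have "closed ((\<lambda>p :: (nat \<Rightarrow> nat) \<times> (nat \<Rightarrow> nat). snd p 0) -` (- {fst (prod_decode m)}))"
        by (intro closed_vimage) (auto simp: closed_def open_discrete)
      then show "closed {p :: (nat \<Rightarrow> nat) \<times> (nat \<Rightarrow> nat). snd p 0 \<noteq> fst (prod_decode m)}"
        by (simp add: vimage_def Compl_eq)
      show "closed ((\<lambda>p. (fst p, \<lambda>j. snd p (Suc j))) -` U (fst (prod_decode m)) (snd (prod_decode m)))"
        by (intro closed_vimage U continuous_on_Baire_reindex)
    qed
    have *: "(\<exists>z. \<forall>m. y \<in> ?A m \<or> (x, z) \<in> ?U m) \<longleftrightarrow> (\<exists>i z. \<forall>k. y \<in> A i k \<or> (x, z) \<in> U i k)" for y x
    proof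
      assume "\<exists>z. \<forall>m. y \<in> ?A m \<or> (x, z) \<in> ?U m"
      then obtain z where z: "y \<in> ?A m \<or> (x, z) \<in> ?U m" for m by blast
      have "y \<in> A (z 0) k \<or> (x, \<lambda>j. z (Suc j)) \<in> U (z 0) k" for k
        using z[of "prod_encode (z 0, k)"] by simp
      then show "\<exists>i z. \<forall>k. y \<in> A i k \<or> (x, z) \<in> U i k" by blast
    next
      assume "\<exists>i z. \<forall>k. y \<in> A i k \<or> (x, z) \<in> U i k"
      then obtain i z where "\<forall>k. y \<in> A i k \<or> (x, z) \<in> U i k" by blast
      then have "\<forall>m. y \<in> ?A m \<or> (x, case_nat i z) \<in> ?U m" by auto
      then show "\<exists>z. \<forall>m. y \<in> ?A m \<or> (x, z) \<in> ?U m" by blast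
    qed
    show "(\<Union>i. B i) = {(y, x). y \<in> space M \<and> (\<exists>z. \<forall>m. y \<in> ?A m \<or> (x, z) \<in> ?U m)}"
      unfolding * B by auto
  qed (rule A)
qed

text \<open>One witness stores countably many witnesses as its columns under the pairing function.\<close>
lemma souslin_INT:
  assumes "\<And>i::nat. souslin M (B i)"
  shows "souslin M (\<Inter>i. B i)"
proof -
  obtain A and U :: "nat \<Rightarrow> nat \<Rightarrow> ((nat \<Rightarrow> nat) \<times> (nat \<Rightarrow> nat)) set"
    where A: "\<And>i k. A i k \<in> sets M" and U: "\<And>i k. closed (U i k)"
    and B: "\<And>i. B i = {(y, x). y \<in> space M \<and> (\<exists>z. \<forall>k. y \<in> A i k \<or> (x, z) \<in> U i k)}"
    by (rule souslin_choice[of M B, OF assms]) (rule that)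
  let ?A = "\<lambda>m. A (fst (prod_decode m)) (snd (prod_decode m))"
  let ?U = "\<lambda>m. (\<lambda>p. (fst p, \<lambda>j. snd p (prod_encode (fst (prod_decode m), j)))) -`
     U (fst (prod_decode m)) (snd (prod_decode m))"
  show ?thesis
  proof (rule souslinI[of ?A _ ?U])
    show "closed (?U m)" for m by (intro closed_vimage U continuous_on_Baire_reindex)
    have *: "(\<exists>z. \<forall>m. y \<in> ?A m \<or> (x, z) \<in> ?U m) \<longleftrightarrow> (\<forall>i. \<exists>z. \<forall>k. y \<in> A i k \<or> (x, z) \<in> U i k)" for y x
    proof
      assume "\<exists>z. \<forall>m. y \<in> ?A m \<or> (x, z) \<in> ?U m"
      then obtain z where z: "y \<in> ?A m \<or> (x, z) \<in> ?U m" for m by blast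
      have "y \<in> A i k \<or> (x, \<lambda>j. z (prod_encode (i, j))) \<in> U i k" for i k
        using z[of "prod_encode (i, k)"] by simp
      then show "\<forall>i. \<exists>z. \<forall>k. y \<in> A i k \<or> (x, z) \<in> U i k" by blast
    next
      assume "\<forall>i. \<exists>z. \<forall>k. y \<in> A i k \<or> (x, z) \<in> U i k"
      then obtain z where z: "\<And>i k. y \<in> A i k \<or> (x, z i) \<in> U i k" by metis
      have "y \<in> ?A m \<or> (x, \<lambda>n. case prod_decode n of (i, j) \<Rightarrow> z i j) \<in> ?U m" for m
        using z[of "fst (prod_decode m)" "snd (prod_decode m)"] by simp
      then show "\<exists>z. \<forall>m. y \<in> ?A m \<or> (x, z) \<in> ?U m" by blast
    qed
    show "(\<Inter>i. B i) = {(y, x). y \<in> space M \<and> (\<exists>z. \<forall>m. y \<in> ?A m \<or> (x, z) \<in> ?U m)}"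
      unfolding * B by auto
  qed (rule A)
qed

lemma souslin_binary:
  assumes "souslin M B" "souslin M C"
  shows "souslin M (B \<union> C)" "souslin M (B \<inter> C)"
proof -
  have *: "souslin M (case i of 0 \<Rightarrow> B | Suc _ \<Rightarrow> C)" for i using assms by (simp split: nat.split)
  have "(\<Union>i. case i of 0 \<Rightarrow> B | Suc _ \<Rightarrow> C) = B \<union> C" "(\<Inter>i. case i of 0 \<Rightarrow> B | Suc _ \<Rightarrow> C) = B \<inter> C"
    by (auto split: nat.splits)
  then show "souslin M (B \<union> C)" "souslin M (B \<inter> C)"
    using souslin_UN[of M "\<lambda>i. case i of 0 \<Rightarrow> B | Suc _ \<Rightarrow> C", OF *]
      souslin_INT[of M "\<lambda>i. case i of 0 \<Rightarrow> B | Suc _ \<Rightarrow> C", OF *] by (simp_all only:)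
qed

text \<open>Closed sets of the Baire space are the sets of branches of trees: points sharing longer and
  longer prefixes with \<open>w\<close> converge to \<open>w\<close>.\<close>
lemma closed_Baire_iff_prefixes:
  fixes C :: "(nat \<Rightarrow> nat) set"
  assumes "closed C"
  shows "w \<in> C \<longleftrightarrow> (\<forall>n. \<exists>v \<in> C. map v [0..<n] = map w [0..<n])"
proof
  assume R: "\<forall>n. \<exists>v \<in> C. map v [0..<n] = map w [0..<n]"
  then obtain v where v: "\<And>n. v n \<in> C" "\<And>n. map (v n) [0..<n] = map w [0..<n]" by metis
  have "(\<lambda>n. v n i) \<longlonglongrightarrow> w i" for i
  proof (rule tendsto_eventually)
    show "eventually (\<lambda>n. v n i = w i) sequentially"
      using eventually_gt_at_top[of i] by eventually_elim (use v(2) in \<open>simp add: map_eq_conv\<close>)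
  qed
  then have "v \<longlonglongrightarrow> w"
    by (simp add: limitin_componentwise flip: limitin_canonical_iff euclidean_product_topology)
  then show "w \<in> C" using assms v(1) by (metis closed_sequentially)
qed auto

lemma clopen_Baire_cylinder:
  "open {w :: nat \<Rightarrow> nat. map w [0..<n] \<in> P}" "closed {w :: nat \<Rightarrow> nat. map w [0..<n] \<in> P}"
proof -
  have *: "open {w :: nat \<Rightarrow> nat. map w [0..<n] \<in> P}" for P
  proof -
    have op: "open {w :: nat \<Rightarrow> nat. w i = c}" for i c
      using open_vimage[OF open_discrete[of "{c}"] continuous_on_product_coordinates[of i]]
      by (simp add: vimage_def)
    have "{w :: nat \<Rightarrow> nat. map w [0..<n] \<in> P} = (\<Union>v \<in> {v. map v [0..<n] \<in> P}. \<Inter>i<n. {w. w i = v i})"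
    proof (intro equalityI subsetI)
      fix w assume "w \<in> (\<Union>v \<in> {v. map v [0..<n] \<in> P}. \<Inter>i<n. {w. w i = v i})"
      then obtain v where "map v [0..<n] \<in> P" "\<And>i. i < n \<Longrightarrow> w i = v i" by auto
      moreover from this(2) have "map w [0..<n] = map v [0..<n]" by simp
      ultimately show "w \<in> {w. map w [0..<n] \<in> P}" by (simp only: mem_Collect_eq)
    qed auto
    also have "open \<dots>" by (intro open_UN open_INT ballI op finite_lessThan)
    finally show ?thesis .
  qed
  show "open {w :: nat \<Rightarrow> nat. map w [0..<n] \<in> P}" by (rule *)
  show "closed {w :: nat \<Rightarrow> nat. map w [0..<n] \<in> P}"
    using *[of "- P"] by (simp add: closed_def Compl_eq)
qed

text \<open>The \<open>n\<close>-th closed set consists of the points whose prefix of length \<open>n\<close> already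
  guarantees membership in the open set.\<close>
lemma open_Baire_eq_UN_closed:
  assumes "open (S :: (nat \<Rightarrow> nat) set)"
  obtains F :: "nat \<Rightarrow> (nat \<Rightarrow> nat) set" where "\<And>i. closed (F i)" "S = (\<Union>i. F i)"
proof
  let ?P = "\<lambda>n. {s. \<forall>v. map v [0..<n] = s \<longrightarrow> v \<in> S}"
  show "closed {w :: nat \<Rightarrow> nat. map w [0..<n] \<in> ?P n}" for n by (rule clopen_Baire_cylinder)
  show "S = (\<Union>n. {w. map w [0..<n] \<in> ?P n})"
    using closed_Baire_iff_prefixes[of "- S"] assms by (auto simp: closed_Compl) blast
qed

text \<open>Sets of this form are not obviously closed under complements, so the inductions over
  \<open>\<sigma>\<close>-algebras carry the complement along.\<close>
lemma souslin_borel: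
  fixes M :: "'a measure" and C :: "(nat \<Rightarrow> nat) set"
  assumes "C \<in> sets borel"
  shows "souslin M (space M \<times> C) \<and> souslin M (space M \<times> - C)"
proof -
  have "C \<in> sigma_sets UNIV (Collect open)" using assms by (simp add: borel_def)
  then show ?thesis
  proof induction
    case (Basic S)
    then obtain F where F: "\<And>i::nat. closed (F i)" "S = (\<Union>i. F i)" using open_Baire_eq_UN_closed by auto
    have "souslin M (\<Union>i. space M \<times> F i)" by (intro souslin_UN souslin_rectangle(2)[of "{}"] F) auto
    moreover have "(\<Union>i. space M \<times> F i) = space M \<times> S" using F by auto
    ultimately show ?case using souslin_rectangle(2)[of "{}" M "- S"] Basic by (simp add: closed_Compl)
  next
    case Empty
    then show ?case using souslin_rectangle[of "{}" M "{}"] souslin_rectangle[of "{}" M UNIV] by simp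
  next
    case (Compl S)
    then show ?case by (simp add: Compl_eq_Diff_UNIV[symmetric])
  next
    case (Union S)
    have "space M \<times> (\<Union>i. S i) = (\<Union>i. space M \<times> S i)" "space M \<times> - (\<Union>i. S i) = (\<Inter>i. space M \<times> - S i)" by auto
    then show ?case using Union by (simp add: souslin_UN souslin_INT)
  qed
qed

lemma souslin_pair_measure:
  assumes "B \<in> sets (M \<Otimes>\<^sub>M (borel :: (nat \<Rightarrow> nat) measure))"
  shows "souslin M B \<and> souslin M (space M \<times> UNIV - B)"
proof -
  have "B \<in> sigma_sets (space M \<times> UNIV) {A \<times> C |A C. A \<in> sets M \<and> C \<in> sets (borel :: (nat \<Rightarrow> nat) measure)}"
    using assms by (simp add: sets_pair_measure)
  then show ?thesis
  proof induction
    case (Basic B)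
    then obtain A C where B: "B = A \<times> C" "A \<in> sets M" "C \<in> sets (borel :: (nat \<Rightarrow> nat) measure)" by auto
    have "B = (A \<times> UNIV) \<inter> (space M \<times> C)"
      "space M \<times> UNIV - B = ((space M - A) \<times> UNIV) \<union> (space M \<times> - C)"
      using B sets.sets_into_space by blast+
    then show ?case
      using B souslin_borel[of C M] souslin_rectangle(1)[of _ M "{}"]
      by (auto intro!: souslin_binary)
  next
    case Empty
    then show ?case using souslin_rectangle[of "{}" M "{}"] souslin_rectangle[of "{}" M UNIV] by simp
  next
    case (Compl S)
    moreover have "S \<subseteq> space M \<times> UNIV"
      using Compl.hyps by (rule sigma_sets_into_sp[rotated]) (use sets.sets_into_space in auto)
    ultimately show ?case by (simp add: double_diff)
  next
    case (Union S)
    have "space M \<times> UNIV - (\<Union>i. S i) = (\<Inter>i. space M \<times> UNIV - S i)" by auto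
    then show ?case
      using souslin_UN[of M S] souslin_INT[of M "\<lambda>i. space M \<times> UNIV - S i"] Union.IH by metis
  qed
qed

text \<open>After merging the two Baire space variables into one, \<open>y\<close> belongs to the set iff some \<open>w\<close>
  satisfies every clause \<open>y \<in> A k \<or> w \<in> V k\<close> with \<open>V k\<close> closed. Testing \<open>w \<in> V k\<close>
  on finite prefixes only gives a tree whose branches are exactly these \<open>w\<close>.\<close>
lemma analytic_set_tree:
  assumes "analytic_set M X"
  obtains T :: "'a \<Rightarrow> nat list set" where
    "\<And>s. {y \<in> space M. s \<in> T y} \<in> sets M"
    "\<And>y s t. prefix s t \<Longrightarrow> t \<in> T y \<Longrightarrow> s \<in> T y"
    "X = {y \<in> space M. \<exists>w. \<forall>n. map w [0..<n] \<in> T y}"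
proof -
  obtain B where B: "B \<in> sets (M \<Otimes>\<^sub>M (borel :: (nat \<Rightarrow> nat) measure))" "X = fst ` B"
    using assms by (auto simp: analytic_set_def)
  obtain A U where "souslin_scheme M A U B"
    using souslin_pair_measure[OF B(1)] unfolding souslin_def by blast
  then have A: "\<And>k. A k \<in> sets M" and U: "\<And>k. closed (U k)"
    and BAU: "B = {(y, x). y \<in> space M \<and> (\<exists>z. \<forall>k. y \<in> A k \<or> (x, z) \<in> U k)}"
    by (auto simp only: souslin_scheme_def)
  define V where "V k = (\<lambda>w. (\<lambda>i. w (2 * i), \<lambda>i. w (2 * i + 1))) -` U k" for k
  have V: "closed (V k)" for k
    unfolding V_def
    by (intro closed_vimage U continuous_on_Pair continuous_on_coordinatewise_then_product
        continuous_on_product_coordinates)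
  have X: "X = {y \<in> space M. \<exists>w. \<forall>k. y \<in> A k \<or> w \<in> V k}"
  proof -
    have "(\<exists>x z. \<forall>k. y \<in> A k \<or> (x, z) \<in> U k) \<longleftrightarrow> (\<exists>w. \<forall>k. y \<in> A k \<or> w \<in> V k)" for y
    proof
      assume "\<exists>x z. \<forall>k. y \<in> A k \<or> (x, z) \<in> U k"
      then obtain x z where xz: "\<forall>k. y \<in> A k \<or> (x, z) \<in> U k" by blast
      have "\<forall>k. y \<in> A k \<or> (\<lambda>i. if even i then x (i div 2) else z (i div 2)) \<in> V k"
        using xz by (simp add: V_def)
      then show "\<exists>w. \<forall>k. y \<in> A k \<or> w \<in> V k" by blast
    qed (auto simp: V_def)
    moreover have "fst ` {(y, x). y \<in> S \<and> Q y x} = {y \<in> S. \<exists>x. Q y x}"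
      for S and Q :: "'a \<Rightarrow> (nat \<Rightarrow> nat) \<Rightarrow> bool" by force
    ultimately show ?thesis unfolding B(2) BAU by simp
  qed
  define T where "T y = {s. \<forall>k. y \<in> A k \<or> (\<exists>v \<in> V k. map v [0..<length s] = s)}" for y
  show thesis
  proof
    fix s
    have "{y \<in> space M. y \<in> A k} = A k" for k using sets.sets_into_space[OF A[of k]] by auto
    then show "{y \<in> space M. s \<in> T y} \<in> sets M"
      unfolding T_def mem_Collect_eq
      by (intro sets.sets_Collect_countable_All sets.sets_Collect_disj sets.sets_Collect_const) (simp add: A)
  next
    fix y s t assume st: "prefix s t" "t \<in> T y"
    have "map v [0..<length s] = s" if "map v [0..<length t] = t" for v
      using that st(1) by (metis length_map length_upt add_0 diff_zero map_append
          append_eq_append_conv prefix_def upt_add_eq_append zero_le length_append)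
    then show "s \<in> T y" using st(2) unfolding T_def by blast
  next
    show "X = {y \<in> space M. \<exists>w. \<forall>n. map w [0..<n] \<in> T y}"
      unfolding X closed_Baire_iff_prefixes[OF V] by (auto simp: T_def)
  qed
qed

section \<open>The Hopf property is co-analytic\<close>

text \<open>A surjective but not injective endomorphism is the witness in the Baire space.\<close>
lemma coanalytic_hopfian_groups: "coanalytic_set group_space hopfian_groups"
proof -
  let ?P = "group_space \<Otimes>\<^sub>M (borel :: (nat \<Rightarrow> nat) measure)"
  (* All compositions are spelled out through their values, so that only the elementary
     conditions fst p q = c and snd p q = c remain to be shown measurable. *)
  define bad where "bad m h \<longleftrightarrow> (\<forall>x y a b c d. m (x, y) = a \<and> h x = b \<and> h y = c \<and> m (b, c) = d \<longrightarrow> h a = d) \<and>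
    (\<forall>b. \<exists>a. h a = b) \<and> (\<exists>a b c. a \<noteq> b \<and> h a = c \<and> h b = c)" for m :: "nat \<times> nat \<Rightarrow> nat" and h :: "nat \<Rightarrow> nat"
  have "h \<in> epi (op_monoid m) (op_monoid m) - iso (op_monoid m) (op_monoid m) \<longleftrightarrow> bad m h" for m h
  proof -
    have "range h = UNIV \<longleftrightarrow> (\<forall>b. \<exists>a. h a = b)" by (metis surj_def)
    moreover have "inj h \<longleftrightarrow> \<not> (\<exists>a b c. a \<noteq> b \<and> h a = c \<and> h b = c)"
      unfolding inj_def by metis
    ultimately show ?thesis
      by (auto simp: bad_def epi_def iso_def hom_def op_monoid_def bij_betw_def)
  qed
  then have hop: "hopfian (op_monoid m) \<longleftrightarrow> \<not> (\<exists>h. bad m h)" if "m \<in> space group_space" for m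
    using that unfolding hopfian_def group_space_def by (auto simp: space_restrict_space)
  have m: "{p \<in> space ?P. fst p q = c} \<in> sets ?P" for q c
  proof -
    have "fst \<in> measurable ?P (borel :: (nat \<times> nat \<Rightarrow> nat) measure)"
      unfolding group_space_def by (intro measurable_compose[OF measurable_fst] measurable_restrict_space1) simp
    then have "(\<lambda>p. fst p q) \<in> measurable ?P borel" by (rule measurable_product_then_coordinatewise)
    from measurable_sets_Collect[OF this, of "\<lambda>n. n = c"] show ?thesis by simp
  qed
  have h: "{p \<in> space ?P. snd p q = c} \<in> sets ?P" for q c
  proof -
    have "snd \<in> measurable ?P (borel :: (nat \<Rightarrow> nat) measure)" by simp
    then have "(\<lambda>p. snd p q) \<in> measurable ?P borel" by (rule measurable_product_then_coordinatewise)
    from measurable_sets_Collect[OF this, of "\<lambda>n. n = c"] show ?thesis by simp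
  qed
  have "{p \<in> space ?P. bad (fst p) (snd p)} \<in> sets ?P"
    unfolding bad_def
    by (intro sets.sets_Collect_conj sets.sets_Collect_countable_All sets.sets_Collect_countable_Ex
        sets.sets_Collect_imp sets.sets_Collect_const m h)
  moreover have "space group_space - hopfian_groups = fst ` {p \<in> space ?P. bad (fst p) (snd p)}"
  proof -
    have "{p \<in> space ?P. bad (fst p) (snd p)} = {(m, h). m \<in> space group_space \<and> bad m h}"
      by (auto simp: space_pair_measure)
    then show ?thesis using hop by (auto simp: hopfian_groups_def image_iff)
  qed
  ultimately show ?thesis
    unfolding coanalytic_set_def analytic_set_def by (auto simp: hopfian_groups_def)
qed

section \<open>Subrings of the rationals attached to nodes\<close>

definition node_prime :: "nat list \<Rightarrow> int" where
  "node_prime s = int (enumerate {p. prime p} (to_nat s))"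

lemma prime_node_prime: "prime (node_prime s)"
  using enumerate_in_set[OF primes_infinite, of "to_nat s"] by (simp add: node_prime_def)

lemma node_prime_dvd_iff: "node_prime s dvd node_prime t \<longleftrightarrow> s = t"
proof
  assume "node_prime s dvd node_prime t"
  then have "node_prime s = node_prime t"
    using prime_node_prime primes_dvd_imp_eq by blast
  then show "s = t"
    using inj_enumerate[OF primes_infinite] by (auto simp: node_prime_def inj_eq)
qed simp

text \<open>The integers localised away from the primes of the initial segments of \<open>t\<close>: all other
  primes are inverted. The empty sequence is an initial segment of \<open>t\<close>, so the condition excludes
  the denominator 0.\<close>
definition node_ring :: "nat list \<Rightarrow> rat set" where
  "node_ring t = {of_int n / of_int d |n d. \<forall>u. prefix u t \<longrightarrow> \<not> node_prime u dvd d}"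

lemma node_ringI:
  assumes "\<And>u. prefix u t \<Longrightarrow> \<not> node_prime u dvd d"
  shows "of_int n / of_int d \<in> node_ring t"
  using assms by (auto simp: node_ring_def)

lemma node_ringE:
  assumes "q \<in> node_ring t"
  obtains n d where "q = of_int n / of_int d" "d \<noteq> 0" "\<And>u. prefix u t \<Longrightarrow> \<not> node_prime u dvd d"
  using assms unfolding node_ring_def by (auto dest: spec[where x = "[]"])

lemma of_int_in_node_ring: "of_int n \<in> node_ring t"
proof -
  have "\<not> node_prime u dvd 1" for u using prime_node_prime not_prime_unit by blast
  then show ?thesis using node_ringI[of t 1 n] by simp
qed

lemma node_ring_add:
  assumes "q \<in> node_ring t" "r \<in> node_ring t" shows "q + r \<in> node_ring t"
proof -
  obtain n d m e where nd: "q = of_int n / of_int d" "d \<noteq> 0" "r = of_int m / of_int e" "e \<noteq> 0"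
    and *: "\<And>u. prefix u t \<Longrightarrow> \<not> node_prime u dvd d" "\<And>u. prefix u t \<Longrightarrow> \<not> node_prime u dvd e"
    using assms by (metis node_ringE)
  have "q + r = of_int (n * e + m * d) / of_int (d * e)" using nd by (simp add: field_simps)
  also have "\<dots> \<in> node_ring t"
    using * prime_dvd_mult_iff[OF prime_node_prime] by (intro node_ringI) blast
  finally show ?thesis .
qed

lemma node_ring_minus:
  assumes "q \<in> node_ring t" shows "- q \<in> node_ring t"
  using assms by (elim node_ringE) (metis minus_divide_left node_ringI of_int_minus)

lemma node_ring_antimono: "prefix s t \<Longrightarrow> node_ring t \<subseteq> node_ring s"
  unfolding node_ring_def using prefix_order.trans by blast

lemma node_ring_divisible:
  assumes "\<not> prefix t s" "q \<in> node_ring s"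
  shows "q / of_int (node_prime t ^ k) \<in> node_ring s"
proof -
  obtain n d where q: "q = of_int n / of_int d" and *: "\<And>u. prefix u s \<Longrightarrow> \<not> node_prime u dvd d"
    using assms(2) by (metis node_ringE)
  have "q / of_int (node_prime t ^ k) = of_int n / of_int (d * node_prime t ^ k)"
    by (simp add: q)
  also have "\<dots> \<in> node_ring s"
  proof (rule node_ringI)
    fix u assume u: "prefix u s"
    then have "\<not> node_prime u dvd node_prime t ^ k"
      using assms(1) prime_node_prime by (metis node_prime_dvd_iff prime_dvd_power)
    with * u show "\<not> node_prime u dvd d * node_prime t ^ k"
      using prime_dvd_mult_iff[OF prime_node_prime] by blast
  qed
  finally show ?thesis .
qed

text \<open>A nonzero rational has only finitely many factors \<open>p\<close> in its numerator, and multiplying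
  by elements of this ring cannot supply any in the denominator.\<close>
lemma node_ring_divisible_imp_zero:
  assumes "\<And>k. \<exists>r \<in> node_ring t. q = of_int (node_prime t ^ k) * r"
  shows "q = 0"
proof (rule ccontr)
  assume "q \<noteq> 0"
  obtain a b where q: "q = of_int a / of_int b" and b: "b \<noteq> 0"
    by (metis Fract_of_int_quotient Rat_cases less_irrefl)
  with \<open>q \<noteq> 0\<close> have a: "a \<noteq> 0" by auto
  have "node_prime t ^ k dvd a" for k
  proof -
    obtain r where r: "r \<in> node_ring t" "q = of_int (node_prime t ^ k) * r" using assms by blast
    obtain n d where nd: "r = of_int n / of_int d" "d \<noteq> 0" "\<not> node_prime t dvd d"
      using r(1) by (metis node_ringE prefix_order.refl)
    have "(of_int (a * d) :: rat) = of_int (node_prime t ^ k * n * b)"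
      using r(2) nd(2) b unfolding q nd(1) by (simp add: field_simps)
    then have "a * d = node_prime t ^ k * n * b" by (simp only: of_int_eq_iff)
    then have "node_prime t ^ k dvd a * d" by simp
    moreover have "coprime (node_prime t ^ k) d"
      using nd(3) prime_node_prime by (simp add: prime_imp_coprime)
    ultimately show ?thesis by (simp add: coprime_dvd_mult_left_iff)
  qed
  moreover have "finite {k. node_prime t ^ k dvd a}"
    using a prime_node_prime[of t] by (intro finite_divisor_powers) (auto simp: not_prime_unit)
  ultimately show False by simp
qed

text \<open>Let \<open>p\<close> be the prime of the first child. Write the denominator of \<open>q\<close> as \<open>p\<^sup>k e\<close> with
  \<open>e\<close> prime to \<open>p\<close>; a Bezout relation between \<open>p\<^sup>k\<close> and \<open>e\<close> separates \<open>q\<close> into a fraction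
  over \<open>e\<close> and one over \<open>p\<^sup>k\<close>. The second child inverts \<open>p\<close>.\<close>
lemma node_ring_split:
  assumes "q \<in> node_ring u" "c \<noteq> c'"
  shows "\<exists>r \<in> node_ring (u @ [c]). q - r \<in> node_ring (u @ [c'])"
proof -
  let ?p = "node_prime (u @ [c])"
  obtain n d where q: "q = of_int n / of_int d" "d \<noteq> 0"
    and d: "\<And>w. prefix w u \<Longrightarrow> \<not> node_prime w dvd d"
    using assms(1) by (metis node_ringE)
  obtain k e where k: "d = ?p ^ k * e" and e: "\<not> ?p dvd e"
    using q(2) prime_node_prime[of "u @ [c]"] by (metis multiplicity_decompose' not_prime_unit)
  have "coprime (?p ^ k) e" using e prime_node_prime by (simp add: prime_imp_coprime)
  then obtain x y where xy: "x * ?p ^ k + y * e = 1"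
    using bezout_int[of "?p ^ k" e] by (auto simp: coprime_iff_gcd_eq_1)
  have nz: "?p \<noteq> 0" "e \<noteq> 0" using q(2) k prime_node_prime[of "u @ [c]"] by auto
  show ?thesis
  proof
    show "of_int (n * x) / of_int e \<in> node_ring (u @ [c])"
    proof (rule node_ringI)
      fix w assume w: "prefix w (u @ [c])"
      show "\<not> node_prime w dvd e"
        using w d[of w] e by (cases "w = u @ [c]") (auto simp: k prefix_snoc)
    qed
    have "q * of_int (x * ?p ^ k + y * e) = of_int (n * x) / of_int e + of_int (n * y) / of_int (?p ^ k)"
      using nz unfolding q(1) k by (simp add: field_simps)
    then have "q - of_int (n * x) / of_int e = of_int (n * y) / of_int (?p ^ k)" by (simp add: xy)
    also have "\<dots> \<in> node_ring (u @ [c'])"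
    proof (rule node_ringI)
      fix w assume "prefix w (u @ [c'])"
      then have "w \<noteq> u @ [c]" using assms(2) by auto
      then show "\<not> node_prime w dvd ?p ^ k"
        using prime_node_prime by (metis node_prime_dvd_iff prime_dvd_power)
    qed
    finally show "q - of_int (n * x) / of_int e \<in> node_ring (u @ [c'])" .
  qed
qed

lemma node_ring_zero [simp]: "0 \<in> node_ring s"
  using of_int_in_node_ring[of 0] by simp

section \<open>The abelian group attached to a tree\<close>

definition tree_functions :: "nat list set \<Rightarrow> (nat list \<Rightarrow> rat) set" where
  "tree_functions D = {f. finite {s. f s \<noteq> 0} \<and> (\<forall>s. f s \<noteq> 0 \<longrightarrow> s \<in> D \<and> f s \<in> node_ring s)}"

definition tree_group :: "nat list set \<Rightarrow> (nat list \<Rightarrow> rat) monoid" where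
  "tree_group D = \<lparr>carrier = tree_functions D, mult = (\<lambda>f g s. f s + g s), one = (\<lambda>_. 0)\<rparr>"

lemma carrier_tree_group [simp]: "carrier (tree_group D) = tree_functions D"
  and mult_tree_group [simp]: "f \<otimes>\<^bsub>tree_group D\<^esub> g = (\<lambda>s. f s + g s)"
  and one_tree_group [simp]: "\<one>\<^bsub>tree_group D\<^esub> = (\<lambda>_. 0)"
  by (simp_all add: tree_group_def)

lemma tree_functionsD:
  assumes "f \<in> tree_functions D"
  shows "finite {s. f s \<noteq> 0}" "s \<notin> D \<Longrightarrow> f s = 0" "f s \<in> node_ring s"
  using assms by (auto simp: tree_functions_def intro: ccontr)
    (metis node_ring_zero)

lemma tree_functionsI:
  assumes "finite {s. f s \<noteq> 0}" "\<And>s. s \<notin> D \<Longrightarrow> f s = 0" "\<And>s. f s \<in> node_ring s"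
  shows "f \<in> tree_functions D"
  using assms by (auto simp: tree_functions_def)

lemma tree_functions_add:
  assumes "f \<in> tree_functions D" "g \<in> tree_functions D"
  shows "(\<lambda>s. f s + g s) \<in> tree_functions D"
proof (rule tree_functionsI)
  show "finite {s. f s + g s \<noteq> 0}"
    by (rule finite_subset[of _ "{s. f s \<noteq> 0} \<union> {s. g s \<noteq> 0}"])
      (use assms in \<open>auto simp: tree_functionsD(1)\<close>)
qed (use assms in \<open>auto simp: tree_functionsD node_ring_add\<close>)

lemma tree_functions_minus:
  "f \<in> tree_functions D \<Longrightarrow> (\<lambda>s. - f s) \<in> tree_functions D"
  by (intro tree_functionsI) (auto simp: tree_functionsD node_ring_minus)

lemma tree_functions_zero: "(\<lambda>_. 0) \<in> tree_functions D"
  by (intro tree_functionsI) auto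

lemma group_tree_group: "group (tree_group D)"
proof (rule groupI)
  fix f assume "f \<in> carrier (tree_group D)"
  then show "\<exists>g \<in> carrier (tree_group D). g \<otimes>\<^bsub>tree_group D\<^esub> f = \<one>\<^bsub>tree_group D\<^esub>"
    by (intro bexI[of _ "\<lambda>s. - f s"]) (auto simp: tree_functions_minus)
qed (auto simp: tree_functions_add tree_functions_zero)

definition node_vec :: "nat list \<Rightarrow> rat \<Rightarrow> nat list \<Rightarrow> rat" where
  "node_vec t q = (\<lambda>s. if s = t then q else 0)"

lemma node_vec_in: "t \<in> D \<Longrightarrow> q \<in> node_ring t \<Longrightarrow> node_vec t q \<in> tree_functions D"
  by (intro tree_functionsI) (auto simp: node_vec_def)

section \<open>Well-founded trees give Hopfian groups\<close>

locale tree_endomorphism =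
  fixes D :: "nat list set" and \<phi> :: "(nat list \<Rightarrow> rat) \<Rightarrow> nat list \<Rightarrow> rat"
  assumes hom: "\<phi> \<in> hom (tree_group D) (tree_group D)"
begin

lemma closed: "f \<in> tree_functions D \<Longrightarrow> \<phi> f \<in> tree_functions D"
  using hom by (auto simp: hom_def)

lemma additive:
  assumes "f \<in> tree_functions D" "g \<in> tree_functions D"
  shows "\<phi> (\<lambda>s. f s + g s) = (\<lambda>s. \<phi> f s + \<phi> g s)"
  using hom assms by (auto simp: hom_def)

lemma zero: "\<phi> (\<lambda>_. 0) = (\<lambda>_. 0)"
  using additive[OF tree_functions_zero tree_functions_zero] by (auto simp: fun_eq_iff)

lemma of_nat_mult:
  assumes "f \<in> tree_functions D"
  shows "(\<lambda>s. of_nat n * f s) \<in> tree_functions D \<and> \<phi> (\<lambda>s. of_nat n * f s) = (\<lambda>s. of_nat n * \<phi> f s)"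
proof (induction n)
  case (Suc n)
  then show ?case
    using tree_functions_add[OF assms, of "\<lambda>s. of_nat n * f s"]
      additive[OF assms, of "\<lambda>s. of_nat n * f s"]
    by (simp add: distrib_right)
qed (simp add: tree_functions_zero zero)

lemma minus:
  assumes "f \<in> tree_functions D"
  shows "\<phi> (\<lambda>s. - f s) = (\<lambda>s. - \<phi> f s)"
proof -
  have "(\<lambda>_. 0) = (\<lambda>s. \<phi> f s + \<phi> (\<lambda>s. - f s) s)"
    using additive[OF assms tree_functions_minus[OF assms]] zero by simp
  then show ?thesis by (simp add: fun_eq_iff eq_neg_iff_add_eq_0 add.commute)
qed

lemma of_int_mult:
  assumes "f \<in> tree_functions D"
  shows "\<phi> (\<lambda>s. of_int n * f s) = (\<lambda>s. of_int n * \<phi> f s)"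
proof (cases n)
  case (nonneg k)
  then show ?thesis using of_nat_mult[OF assms, of k] by simp
next
  case (neg k)
  have "of_int n * q = - (of_nat (Suc k) * q)" for q :: rat by (simp add: neg algebra_simps)
  then show ?thesis
    using of_nat_mult[OF assms, of "Suc k"] minus[of "\<lambda>s. of_nat (Suc k) * f s"] by simp
qed

text \<open>If \<open>v\<close> lives on nodes that do not extend \<open>t\<close>, then it is divisible in the group by every
  power of the prime of \<open>t\<close>. So is the entry of its image at \<open>t\<close>, which must vanish.\<close>
lemma vanishes_outside_cone:
  assumes v: "v \<in> tree_functions D" and "\<And>s. prefix t s \<Longrightarrow> v s = 0"
  shows "\<phi> v t = 0"
proof (rule node_ring_divisible_imp_zero)
  fix k
  let ?c = "of_int (node_prime t ^ k) :: rat" and ?w = "\<lambda>s. v s / of_int (node_prime t ^ k)"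
  have c: "?c \<noteq> 0" using prime_node_prime[of t] by auto
  have w: "?w \<in> tree_functions D"
  proof (rule tree_functionsI)
    show "finite {s. ?w s \<noteq> 0}" using c tree_functionsD(1)[OF v] by simp
    show "?w s \<in> node_ring s" for s
      using node_ring_divisible[of t s "v s" k] tree_functionsD(3)[OF v] assms(2)[of s]
      by (cases "prefix t s") auto
  qed (simp add: tree_functionsD(2)[OF v])
  have "(\<lambda>s. ?c * ?w s) = v" using c by simp
  then have "\<phi> v = (\<lambda>s. ?c * \<phi> ?w s)" using of_int_mult[OF w, of "node_prime t ^ k"] by simp
  then show "\<exists>r \<in> node_ring t. \<phi> v t = ?c * r" using tree_functionsD(3)[OF closed[OF w]] by auto
qed

text \<open>Triangularity: what \<open>v\<close> does off the cone above \<open>t\<close> is invisible at \<open>t\<close>.\<close>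
lemma eq_diagonal:
  assumes v: "v \<in> tree_functions D" and t: "t \<in> D" and "\<And>s. strict_prefix t s \<Longrightarrow> v s = 0"
  shows "\<phi> v t = \<phi> (node_vec t (v t)) t"
proof -
  let ?x = "node_vec t (v t)"
  have x: "?x \<in> tree_functions D" using node_vec_in[OF t] tree_functionsD(3)[OF v] by blast
  let ?w = "\<lambda>s. v s + - ?x s"
  have w: "?w \<in> tree_functions D" by (intro tree_functions_add tree_functions_minus v x)
  have "\<phi> ?w t = 0"
    using assms(3) by (intro vanishes_outside_cone[OF w]) (auto simp: node_vec_def strict_prefix_def)
  moreover have "\<phi> ?w = (\<lambda>s. \<phi> v s + - \<phi> ?x s)"
    using additive[OF v tree_functions_minus[OF x]] minus[OF x] by simp
  ultimately show ?thesis by simp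
qed

definition zero_diagonal :: "nat list \<Rightarrow> bool" where
  "zero_diagonal t \<longleftrightarrow> t \<in> D \<and> (\<forall>q \<in> node_ring t. \<phi> (node_vec t q) t = 0)"

text \<open>The ring of \<open>t\<close> has rank one: any two nonzero elements have a common nonzero integer
  multiple, so an additive map to the rationals that kills one of them kills all.\<close>
lemma zero_diagonalI:
  assumes t: "t \<in> D" and q: "q \<in> node_ring t" "q \<noteq> 0" and "\<phi> (node_vec t q) t = 0"
  shows "zero_diagonal t"
  unfolding zero_diagonal_def
proof (intro conjI ballI t)
  fix r assume r: "r \<in> node_ring t"
  obtain a b where ab: "q = of_int a / of_int b" "b \<noteq> 0" "a \<noteq> 0" 
    using q by (metis div_0 node_ringE of_int_0)
  obtain c d where cd: "r = of_int c / of_int d" "d \<noteq> 0" using r by (metis node_ringE)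
  have "(\<lambda>s. of_int (a * d) * node_vec t r s) = (\<lambda>s. of_int (b * c) * node_vec t q s)"
    using ab cd by (auto simp: node_vec_def fun_eq_iff field_simps)
  then have "of_int (a * d) * \<phi> (node_vec t r) t = of_int (b * c) * \<phi> (node_vec t q) t"
    using of_int_mult[OF node_vec_in[OF t r], of "a * d"] of_int_mult[OF node_vec_in[OF t q(1)], of "b * c"]
    by (auto dest: fun_cong[of _ _ t])
  then show "\<phi> (node_vec t r) t = 0" using assms(4) ab cd by simp
qed

lemma exists_maximal_in_support:
  assumes "v \<in> tree_functions D" "v s \<noteq> 0" "P s"
  obtains t where "v t \<noteq> 0" "P t" "\<And>u. strict_prefix t u \<Longrightarrow> P u \<Longrightarrow> v u = 0"
proof -
  have fin: "finite {s. v s \<noteq> 0 \<and> P s}"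
    using tree_functionsD(1)[OF assms(1)] by (rule finite_subset[rotated]) auto
  then have "Max (length ` {s. v s \<noteq> 0 \<and> P s}) \<in> length ` {s. v s \<noteq> 0 \<and> P s}"
    using assms(2,3) by (intro Max_in) auto
  then obtain t where t: "v t \<noteq> 0" "P t" "length t = Max (length ` {s. v s \<noteq> 0 \<and> P s})"
    by auto
  have "v u = 0" if "strict_prefix t u" "P u" for u
  proof (rule ccontr)
    assume "v u \<noteq> 0"
    then have "length u \<le> length t" unfolding t(3) using fin that(2) by (intro Max_ge) auto
    then show False using prefix_length_less[OF that(1)] by simp
  qed
  with t that show thesis by blast
qed

text \<open>At a maximal node of the support of a kernel element only the diagonal entry is seen.\<close>
lemma zero_diagonal_if_not_injective:
  assumes v: "v \<in> tree_functions D" and "v \<noteq> (\<lambda>_. 0)" "\<phi> v = (\<lambda>_. 0)"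
  shows "\<exists>t. zero_diagonal t"
proof -
  obtain s where "v s \<noteq> 0" using assms(2) by auto
  then obtain t where t: "v t \<noteq> 0" "\<And>u. strict_prefix t u \<Longrightarrow> v u = 0"
    using exists_maximal_in_support[OF v, of s "\<lambda>_. True"] by auto
  have "t \<in> D" using t(1) tree_functionsD(2)[OF v] by blast
  moreover have "\<phi> (node_vec t (v t)) t = 0"
    using eq_diagonal[OF v \<open>t \<in> D\<close> t(2)] assms(3) by simp
  ultimately show ?thesis using zero_diagonalI t(1) tree_functionsD(3)[OF v] by blast
qed

text \<open>A preimage \<open>v\<close> of the unit vector at \<open>t\<close> must have support properly above \<open>t\<close>, because
  the diagonal entry at \<open>t\<close> contributes nothing. At a maximal such node \<open>u\<close> the image of \<open>v\<close> is
  zero although \<open>v\<close> is not, so the diagonal entry at \<open>u\<close> is zero.\<close>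
lemma zero_diagonal_extends:
  assumes surj: "\<phi> ` tree_functions D = tree_functions D" and t: "zero_diagonal t"
  shows "\<exists>u. strict_prefix t u \<and> zero_diagonal u"
proof -
  have D: "t \<in> D" using t by (simp add: zero_diagonal_def)
  have "node_vec t 1 \<in> tree_functions D" using node_vec_in[OF D] of_int_in_node_ring[of 1] by simp
  then obtain v where v: "v \<in> tree_functions D" "\<phi> v = node_vec t 1" using surj by (metis imageE)
  have "\<not> (\<forall>s. strict_prefix t s \<longrightarrow> v s = 0)"
  proof
    assume "\<forall>s. strict_prefix t s \<longrightarrow> v s = 0"
    then have "\<phi> v t = \<phi> (node_vec t (v t)) t" by (intro eq_diagonal[OF v(1) D]) auto
    then show False using t v tree_functionsD(3)[OF v(1)] by (simp add: zero_diagonal_def node_vec_def)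
  qed
  then obtain u where u: "v u \<noteq> 0" "strict_prefix t u" "\<And>w. strict_prefix u w \<Longrightarrow> strict_prefix t w \<Longrightarrow> v w = 0"
    using exists_maximal_in_support[OF v(1), of _ "strict_prefix t"] by metis
  have uD: "u \<in> D" using u(1) tree_functionsD(2)[OF v(1)] by blast
  have "\<phi> v u = \<phi> (node_vec u (v u)) u"
    using u by (intro eq_diagonal[OF v(1) uD]) (meson prefix_order.less_trans)
  moreover have "\<phi> v u = 0" using v(2) u(2) by (auto simp: node_vec_def)
  ultimately show ?thesis using zero_diagonalI[OF uD] u tree_functionsD(3)[OF v(1)] by auto
qed

end

definition has_branch :: "nat list set \<Rightarrow> bool" where
  "has_branch T \<longleftrightarrow> (\<exists>x :: nat \<Rightarrow> nat. \<forall>n. map x [0..<n] \<in> T)"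

lemma has_branch_if_ascending:
  assumes T: "\<And>s t. prefix s t \<Longrightarrow> t \<in> T \<Longrightarrow> s \<in> T"
    and c: "\<And>n. c n \<in> T" "\<And>n. strict_prefix (c n) (c (Suc n))"
  shows "has_branch T"
proof -
  have pre: "prefix (c m) (c n)" if "m \<le> n" for m n
    using that by (induction n rule: dec_induct) (auto intro: prefix_order.trans c(2) prefix_order.less_imp_le)
  have len: "n \<le> length (c n)" for n
    by (induction n) (auto intro: order.strict_trans1 prefix_length_less[OF c(2)] simp: Suc_le_eq)
  define x where "x i = c (Suc i) ! i" for i
  have nth: "x i = c n ! i" if "i < n" for i n
  proof -
    have "prefix (c (Suc i)) (c n)" using pre that by simp
    then show ?thesis using len[of "Suc i"] by (auto simp: x_def prefix_def nth_append)
  qed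
  have "map x [0..<n] = take n (c n)" for n
    by (rule nth_equalityI) (use len nth in auto)
  then show ?thesis unfolding has_branch_def by (metis T c(1) take_is_prefix)
qed

lemma hopfian_if_no_branch:
  assumes T: "\<And>s t. prefix s t \<Longrightarrow> t \<in> T \<Longrightarrow> s \<in> T" and "\<not> has_branch T"
  shows "hopfian (tree_group T)"
  unfolding hopfian_def
proof (intro conjI ballI group_tree_group)
  fix \<phi> assume "\<phi> \<in> epi (tree_group T) (tree_group T)"
  then have hom: "\<phi> \<in> hom (tree_group T) (tree_group T)"
    and surj: "\<phi> ` tree_functions T = tree_functions T" by (auto simp: epi_def)
  interpret tree_endomorphism T \<phi> using hom by unfold_locales
  have no: "\<not> zero_diagonal t" for t
  proof
    assume "zero_diagonal t"
    then obtain c where c: "\<And>n. zero_diagonal (c n)" "\<And>n. strict_prefix (c n) (c (Suc n))"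
      using dependent_nat_choice[of "\<lambda>_. zero_diagonal" "\<lambda>_. strict_prefix"] zero_diagonal_extends[OF surj] by blast
    have "has_branch T"
      using T by (rule has_branch_if_ascending[of T c]) (use c zero_diagonal_def in auto)
    then show False using assms(2) by simp
  qed
  have "inj_on \<phi> (tree_functions T)"
  proof (rule inj_onI)
    fix f g assume fg: "f \<in> tree_functions T" "g \<in> tree_functions T" "\<phi> f = \<phi> g"
    let ?h = "\<lambda>s. f s + - g s"
    have "?h \<in> tree_functions T" by (intro tree_functions_add tree_functions_minus fg)
    moreover have "\<phi> ?h = (\<lambda>_. 0)"
      using additive[OF fg(1) tree_functions_minus[OF fg(2)]] minus[OF fg(2)] fg(3) by simp
    ultimately have "?h = (\<lambda>_. 0)" using zero_diagonal_if_not_injective no by blast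
    then show "f = g" by (simp add: fun_eq_iff)
  qed
  then show "\<phi> \<in> iso (tree_group T) (tree_group T)"
    using hom surj by (auto simp: iso_def bij_betw_def)
qed

section \<open>Branches give non-Hopfian groups\<close>

text \<open>The nodes \<open>2 c\<close> and \<open>2 c + 1\<close> are two copies of \<open>c\<close>, so every node of the tree
  other than the root gets a sibling lying over the same node.\<close>
definition doubled :: "nat list set \<Rightarrow> nat list set" where
  "doubled T = {s. map (\<lambda>n. n div 2) s \<in> T}"

lemma doubled_prefix_closed:
  assumes "\<And>s t. prefix s t \<Longrightarrow> t \<in> T \<Longrightarrow> s \<in> T"
  shows "prefix s t \<Longrightarrow> t \<in> doubled T \<Longrightarrow> s \<in> doubled T"
  using assms map_mono_prefix unfolding doubled_def by blast

lemma has_branch_doubled_iff: "has_branch (doubled T) \<longleftrightarrow> has_branch T"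
proof
  assume "has_branch (doubled T)"
  then obtain x where "\<And>n. map (\<lambda>k. k div 2) (map x [0..<n]) \<in> T"
    by (auto simp: has_branch_def doubled_def)
  then show "has_branch T" unfolding has_branch_def
    by (intro exI[of _ "\<lambda>i. x i div 2"]) (simp add: comp_def)
next
  assume "has_branch T"
  then obtain x where "\<And>n. map x [0..<n] \<in> T" by (auto simp: has_branch_def)
  then show "has_branch (doubled T)" unfolding has_branch_def doubled_def
    by (intro exI[of _ "\<lambda>i. 2 * x i"]) (simp add: comp_def)
qed

lemma not_hopfian_if_branch:
  assumes x: "\<And>n. map x [0..<n] \<in> T"
  shows "\<not> hopfian (tree_group (doubled T))"
proof
  let ?D = "doubled T"
  assume hop: "hopfian (tree_group ?D)"
  (* The binary subtree lying over the branch x; a s and b s are the two children of s in it. *)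
  define B where "B = {s. map (\<lambda>n. n div 2) s = map x [0..<length s]}"
  define a b where "a s = s @ [2 * x (length s)]" and "b s = s @ [2 * x (length s) + 1]" for s
  have B_D: "s \<in> ?D" if "s \<in> B" for s
    using that x[of "length s"] by (simp add: B_def doubled_def)
  have B_Nil: "[] \<in> B" by (simp add: B_def)
  have B_ab: "a s \<in> B" "b s \<in> B" if "s \<in> B" for s
    using that by (simp_all add: B_def a_def b_def)
  have B_cases: "s = [] \<or> (\<exists>u \<in> B. s = a u \<or> s = b u)" if "s \<in> B" for s
  proof (cases s rule: rev_cases)
    case (snoc u c)
    then have "u \<in> B" "c div 2 = x (length u)" using that by (auto simp: B_def)
    moreover from this have "c = 2 * x (length u) \<or> c = 2 * x (length u) + 1" by presburger
    ultimately show ?thesis unfolding snoc a_def b_def by auto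
  qed simp
  have ab_inj: "a s = a u \<longleftrightarrow> s = u" "b s = b u \<longleftrightarrow> s = u" "a s \<noteq> b u" "b u \<noteq> a s" "a s \<noteq> []" "b s \<noteq> []" for s u
    by (auto simp: a_def b_def)
  define \<phi> :: "(nat list \<Rightarrow> rat) \<Rightarrow> nat list \<Rightarrow> rat"
    where "\<phi> f = (\<lambda>s. if s \<in> B then f (a s) + f (b s) else f s)" for f
  have clo: "\<phi> f \<in> tree_functions ?D" if f: "f \<in> tree_functions ?D" for f
  proof (rule tree_functionsI)
    have "{s. \<phi> f s \<noteq> 0} \<subseteq> {s. f s \<noteq> 0} \<union> butlast ` {s. f s \<noteq> 0}"
    proof
      fix s assume "s \<in> {s. \<phi> f s \<noteq> 0}"
      then have "f s \<noteq> 0 \<or> f (a s) \<noteq> 0 \<or> f (b s) \<noteq> 0" by (auto simp: \<phi>_def split: if_splits)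
      moreover have "butlast (a s) = s" "butlast (b s) = s" by (simp_all add: a_def b_def)
      ultimately show "s \<in> {s. f s \<noteq> 0} \<union> butlast ` {s. f s \<noteq> 0}" by (metis (mono_tags, lifting) UnI1 UnI2 image_eqI mem_Collect_eq)
    qed
    then show "finite {s. \<phi> f s \<noteq> 0}" using tree_functionsD(1)[OF f] finite_subset by blast
    show "\<phi> f s = 0" if "s \<notin> ?D" for s
      using that B_D tree_functionsD(2)[OF f] by (auto simp: \<phi>_def)
    show "\<phi> f s \<in> node_ring s" for s
    proof -
      have "f (a s) \<in> node_ring s" "f (b s) \<in> node_ring s"
        using tree_functionsD(3)[OF f] node_ring_antimono[of s "a s"] node_ring_antimono[of s "b s"]
        by (auto simp: a_def b_def)
      then show ?thesis using tree_functionsD(3)[OF f] by (simp add: \<phi>_def node_ring_add)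
    qed
  qed
  have hom: "\<phi> \<in> hom (tree_group ?D) (tree_group ?D)"
  proof -
    have "\<phi> (\<lambda>s. f s + g s) = (\<lambda>s. \<phi> f s + \<phi> g s)" for f g
      by (auto simp: \<phi>_def)
    then show ?thesis using clo by (simp add: hom_def)
  qed
  have surj: "g \<in> \<phi> ` tree_functions ?D" if g: "g \<in> tree_functions ?D" for g
  proof -
    (* Zero is split as 0 + 0, which keeps the support of the preimage finite. *)
    have "\<exists>r. r \<in> node_ring (a u) \<and> g u - r \<in> node_ring (b u) \<and> (g u = 0 \<longrightarrow> r = 0)" for u
    proof (cases "g u = 0")
      case False
      then show ?thesis
        using node_ring_split[OF tree_functionsD(3)[OF g, of u]] unfolding a_def b_def
        by (metis n_not_Suc_n Suc_eq_plus1)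
    qed auto
    then obtain r where r: "\<And>u. r u \<in> node_ring (a u)" "\<And>u. g u - r u \<in> node_ring (b u)" "\<And>u. g u = 0 \<Longrightarrow> r u = 0"
      by metis
    define f where "f s = (if s \<notin> B then g s else if s = [] then 0
       else if s = a (butlast s) then r (butlast s) else g (butlast s) - r (butlast s))" for s
    have fa: "f (a u) = r u" and fb: "f (b u) = g u - r u" if "u \<in> B" for u
      using that B_ab[OF that] by (auto simp: f_def ab_inj) (auto simp: a_def b_def)
    have "f \<in> tree_functions ?D"
    proof (rule tree_functionsI)
      have "{s. f s \<noteq> 0} \<subseteq> {s. g s \<noteq> 0} \<union> a ` {s. g s \<noteq> 0} \<union> b ` {s. g s \<noteq> 0}"
      proof
        fix s assume s: "s \<in> {s. f s \<noteq> 0}"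
        show "s \<in> {s. g s \<noteq> 0} \<union> a ` {s. g s \<noteq> 0} \<union> b ` {s. g s \<noteq> 0}"
        proof (cases "s \<in> B")
          case True
          with s obtain u where "u \<in> B" "s = a u \<or> s = b u" using B_cases by (fastforce simp: f_def)
          then show ?thesis using s fa fb r(3) by fastforce
        qed (use s in \<open>simp add: f_def\<close>)
      qed
      then show "finite {s. f s \<noteq> 0}" using tree_functionsD(1)[OF g] by (auto intro: finite_subset)
      show "f s = 0" if "s \<notin> ?D" for s
        using that B_D tree_functionsD(2)[OF g] by (auto simp: f_def)
      show "f s \<in> node_ring s" for s
      proof (cases "s \<in> B")
        case True
        then consider "s = []" | u where "u \<in> B" "s = a u" | u where "u \<in> B" "s = b u"
          using B_cases by blast
        then show ?thesis
        proof cases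
          case 1 then show ?thesis using True by (simp add: f_def)
        qed (use fa fb r in auto)
      qed (use tree_functionsD(3)[OF g] in \<open>simp add: f_def\<close>)
    qed
    moreover have "\<phi> f = g" by (auto simp: \<phi>_def fun_eq_iff fa fb) (simp add: f_def)
    ultimately show ?thesis by blast
  qed
  have "\<phi> \<in> epi (tree_group ?D) (tree_group ?D)"
    using hom surj clo by (auto simp: epi_def)
  then have "\<phi> \<in> iso (tree_group ?D) (tree_group ?D)" using hop by (simp add: hopfian_def)
  then have inj: "inj_on \<phi> (tree_functions ?D)" by (simp add: iso_def bij_betw_def)
  have "node_vec [] 1 \<in> tree_functions ?D"
    using B_D[OF B_Nil] of_int_in_node_ring[of 1] by (intro node_vec_in) auto
  moreover have "\<phi> (node_vec [] 1) = \<phi> (\<lambda>_. 0)"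
    using B_Nil ab_inj by (auto simp: \<phi>_def node_vec_def fun_eq_iff)
  ultimately have "node_vec [] 1 = (\<lambda>_. 0)" using inj tree_functions_zero by (auto dest: inj_onD)
  then show False by (auto simp: node_vec_def dest: fun_cong[of _ _ "[]"])
qed

section \<open>Coding groups on the natural numbers in a Borel way\<close>

lemma measurable_enumerate:
  fixes N :: "'a \<Rightarrow> nat set"
  assumes "\<And>n. {y \<in> space M. n \<in> N y} \<in> sets M" and inf: "\<And>y. y \<in> space M \<Longrightarrow> infinite (N y)"
  shows "(\<lambda>y. enumerate (N y) k) \<in> measurable M (count_space UNIV)"
proof -
  have N [measurable]: "Measurable.pred M (\<lambda>y. n \<in> N y)" for n
    using assms(1) by (simp add: pred_def)
  show ?thesis
  proof (induction k)
    case 0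
    show ?case unfolding enumerate_0 by (intro measurable_Least N)
  next
    case (Suc k)
    note Suc [measurable]
    have "Measurable.pred M (\<lambda>y. n \<in> N y \<and> enumerate (N y) k < n)" for n by measurable
    then have "(\<lambda>y. LEAST n. n \<in> N y \<and> enumerate (N y) k < n) \<in> measurable M (count_space UNIV)"
      by (rule measurable_Least)
    then show ?case
      by (rule measurable_cong[THEN iffD1, rotated]) (simp add: enumerate_Suc'' inf)
  qed
qed

text \<open>Transport of structure: the bijection \<open>e\<close> carries the group laws over to \<open>m\<close>.\<close>
lemma op_monoid_iso:
  assumes G: "group G" and e: "bij_betw e (UNIV :: nat set) (carrier G)"
    and m: "\<And>i j. e (m (i, j)) = e i \<otimes>\<^bsub>G\<^esub> e j"
  shows "group (op_monoid m)" "e \<in> iso (op_monoid m) G"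
proof -
  interpret group G by fact
  have inj: "e i = e j \<longleftrightarrow> i = j" for i j using e by (auto simp: bij_betw_def inj_eq)
  have car: "e i \<in> carrier G" for i using e by (auto simp: bij_betw_def)
  have ex: "\<exists>i. e i = g" if "g \<in> carrier G" for g using e that by (metis bij_betw_def imageE)
  have "\<exists>x y. m (a, x) = b \<and> m (y, a) = b" for a b
  proof -
    obtain x y where "e x = inv\<^bsub>G\<^esub> (e a) \<otimes>\<^bsub>G\<^esub> e b" "e y = e b \<otimes>\<^bsub>G\<^esub> inv\<^bsub>G\<^esub> (e a)"
      using ex car by (meson inv_closed m_closed)
    then have "e (m (a, x)) = e b" "e (m (y, a)) = e b"
      using car by (simp_all add: m m_assoc[symmetric]) (simp add: m_assoc)
    then show ?thesis using inj by blast
  qed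
  moreover have "m (m (x, y), z) = m (x, m (y, z))" for x y z
    using car by (subst inj[symmetric]) (simp add: m m_assoc)
  ultimately show "group (op_monoid m)" by (simp add: group_op_iff)
  show "e \<in> iso (op_monoid m) G"
    using e by (auto simp: iso_def hom_def op_monoid_def m car)
qed

text \<open>All groups of the family live inside one countable set \<open>C\<close> and share their multiplication.
  Numbering \<open>C\<close> once and for all and listing each carrier in increasing order yields
  the multiplication table on \<open>\<nat>\<close>; least-number search keeps everything Borel in \<open>y\<close>.\<close>
lemma measurable_op_realization:
  fixes G :: "'a \<Rightarrow> 'c monoid" and mul :: "'c \<Rightarrow> 'c \<Rightarrow> 'c"
  assumes C: "countable C" and sub: "\<And>y. carrier (G y) \<subseteq> C" and mul: "\<And>y. mult (G y) = mul"
    and grp: "\<And>y. y \<in> space M \<Longrightarrow> group (G y)"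
    and inf: "\<And>y. y \<in> space M \<Longrightarrow> infinite (carrier (G y))"
    and meas: "\<And>c. {y \<in> space M. c \<in> carrier (G y)} \<in> sets M"
  obtains f where "f \<in> measurable M group_space"
    "\<And>y. y \<in> space M \<Longrightarrow> \<exists>e. e \<in> iso (op_monoid (f y)) (G y)"
proof -
  define N where "N y = to_nat_on C ` carrier (G y)" for y
  define e where "e y k = from_nat_into C (enumerate (N y) k)" for y k
  define f where "f y = (\<lambda>(i, j). LEAST k. e y k = mul (e y i) (e y j))" for y
  have inj: "inj_on (to_nat_on C) (carrier (G y))" for y
    using C sub by (meson inj_on_subset inj_on_to_nat_on)
  have infN: "infinite (N y)" if "y \<in> space M" for y
    using inf[OF that] inj by (simp add: N_def finite_image_iff)
  have bij: "bij_betw (e y) UNIV (carrier (G y))" if y: "y \<in> space M" for y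
  proof -
    have "bij_betw (from_nat_into C) (N y) (carrier (G y))"
      unfolding N_def using C sub[of y]
      by (intro bij_betw_byWitness[where f' = "to_nat_on C"]) (auto simp: subset_iff)
    from bij_betw_trans[OF bij_enumerate[OF infN[OF y]] this]
    show ?thesis by (simp add: e_def[abs_def] comp_def)
  qed
  have e_f: "e y (f y (i, j)) = e y i \<otimes>\<^bsub>G y\<^esub> e y j" if y: "y \<in> space M" for y i j
  proof -
    interpret group "G y" using grp y .
    have "e y i \<otimes>\<^bsub>G y\<^esub> e y j \<in> carrier (G y)" using bij[OF y] by (auto simp: bij_betw_def)
    then obtain k where "e y k = mul (e y i) (e y j)"
      using bij[OF y] unfolding mul by (metis bij_betw_def imageE)
    then show ?thesis unfolding f_def mul by (auto intro: LeastI)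
  qed
  have iso: "group (op_monoid (f y))" "e y \<in> iso (op_monoid (f y)) (G y)" if y: "y \<in> space M" for y
    using op_monoid_iso[OF grp[OF y] bij[OF y], of "f y"] e_f[OF y] by blast+
  have N_sets: "{y \<in> space M. n \<in> N y} \<in> sets M" for n
  proof -
    have "n \<in> N y \<longleftrightarrow> from_nat_into C n \<in> carrier (G y) \<and> to_nat_on C (from_nat_into C n) = n" for y
      unfolding N_def using C sub[of y] by (auto simp: image_iff) (metis from_nat_into_to_nat_on subsetD)+
    then show ?thesis by (simp add: sets.sets_Collect_conj meas)
  qed
  have en: "(\<lambda>y. enumerate (N y) k) \<in> measurable M (count_space UNIV)" for k
    using N_sets infN by (rule measurable_enumerate)
  have rel: "Measurable.pred M (\<lambda>y. R (enumerate (N y) k) (enumerate (N y) i) (enumerate (N y) j))"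
    for R :: "nat \<Rightarrow> nat \<Rightarrow> nat \<Rightarrow> bool" and i j k
    by (intro measurable_compose_countable[OF _ en, of "\<lambda>a y. R a (enumerate (N y) i) (enumerate (N y) j)"]
        measurable_compose_countable[OF _ en, of "\<lambda>b y. R _ b (enumerate (N y) j)"]
        measurable_compose_countable[OF _ en, of "\<lambda>c y. R _ _ c"] measurable_const) simp
  have "(\<lambda>y. f y p) \<in> measurable M (count_space UNIV)" for p
  proof (cases p)
    case (Pair i j)
    show ?thesis unfolding Pair f_def case_prod_conv e_def
      by (intro measurable_Least
          rel[of "\<lambda>a b c. from_nat_into C a = mul (from_nat_into C b) (from_nat_into C c)"])
  qed
  then have "(\<lambda>y. f y p) \<in> borel_measurable M" for p
    by (simp add: measurable_cong_sets[OF refl sets_borel_eq_count_space])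
  then have "f \<in> borel_measurable M" by (rule measurable_coordinatewise_then_product)
  then have "f \<in> measurable M group_space"
    unfolding group_space_def using iso(1) by (intro measurable_restrict_space2) auto
  with iso(2) that show thesis by blast
qed

section \<open>The reduction\<close>

text \<open>Conjugate a given epimorphism of \<open>G\<close> to one of \<open>H\<close>.\<close>
lemma hopfian_iso:
  assumes G: "group G" and H: "hopfian H" and e: "e \<in> iso G H"
  shows "hopfian G"
  unfolding hopfian_def
proof (intro conjI ballI G)
  fix \<phi> assume \<phi>: "\<phi> \<in> epi G G"
  let ?e' = "inv_into (carrier G) e"
  have e': "?e' \<in> iso H G" using group.iso_set_sym[OF G e] .
  have bij: "bij_betw e (carrier G) (carrier H)" "bij_betw ?e' (carrier H) (carrier G)"
    using e e' by (auto simp: iso_def)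
  have "e \<circ> \<phi> \<circ> ?e' \<in> hom H H"
    using e e' \<phi> by (auto simp: iso_def epi_def intro!: hom_compose)
  moreover have "(e \<circ> \<phi> \<circ> ?e') ` carrier H = carrier H"
    using bij \<phi> unfolding image_comp[symmetric] by (simp add: bij_betw_def epi_def)
  ultimately have "e \<circ> \<phi> \<circ> ?e' \<in> iso H H" using H by (simp add: hopfian_def epi_def)
  then have "inj_on (e \<circ> \<phi> \<circ> ?e') (carrier H)" by (simp add: iso_def bij_betw_def)
  then have "inj_on (e \<circ> \<phi>) (carrier G)"
    using bij(2) by (metis bij_betw_def inj_on_imageI)
  then have "inj_on \<phi> (carrier G)" by (rule inj_on_imageI2)
  then show "\<phi> \<in> iso G G" using \<phi> by (simp add: iso_def epi_def bij_betw_def)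
qed

lemma countable_finite_support: "countable {f :: nat list \<Rightarrow> rat. finite {s. f s \<noteq> 0}}"
proof (rule countable_subset)
  let ?g = "\<lambda>(l :: (nat list \<times> rat) list) s. case map_of l s of None \<Rightarrow> 0 | Some q \<Rightarrow> q"
  show "{f :: nat list \<Rightarrow> rat. finite {s. f s \<noteq> 0}} \<subseteq> range ?g"
  proof
    fix f :: "nat list \<Rightarrow> rat" assume "f \<in> {f. finite {s. f s \<noteq> 0}}"
    then obtain xs where xs: "set xs = {s. f s \<noteq> 0}" using finite_list by auto
    have "f = ?g (map (\<lambda>s. (s, f s)) xs)"
      using xs by (auto simp: fun_eq_iff map_of_map_restrict restrict_map_def)
    then show "f \<in> range ?g" by blast
  qed
qed simp

lemma infinite_tree_functions:
  assumes "[] \<in> D" shows "infinite (tree_functions D)"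
proof
  assume "finite (tree_functions D)"
  moreover have "range (\<lambda>n. node_vec [] (of_nat n)) \<subseteq> tree_functions D"
    using assms of_int_in_node_ring[of "int _"] by (auto intro: node_vec_in)
  ultimately have "finite (range (\<lambda>n. node_vec [] (of_nat n)))" by (rule finite_subset[rotated])
  moreover have "inj (\<lambda>n. node_vec [] (of_nat n))"
    by (rule injI) (auto simp: node_vec_def dest: fun_cong[of _ _ "[]"])
  ultimately show False using finite_imageD by blast
qed

theorem theorem1:
  shows "coanalytic_complete TYPE('b) group_space hopfian_groups"
  unfolding coanalytic_complete_def
proof (intro conjI allI impI standard_borel_group_space coanalytic_hopfian_groups)
  fix Y :: "'b measure" and B assume B: "coanalytic_set Y B"
  then have "analytic_set Y (space Y - B)" by (simp add: coanalytic_set_def)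
  then obtain T :: "'b \<Rightarrow> nat list set" where T: "\<And>s. {y \<in> space Y. s \<in> T y} \<in> sets Y"
    and pre: "\<And>y s t. prefix s t \<Longrightarrow> t \<in> T y \<Longrightarrow> s \<in> T y"
    and X: "space Y - B = {y \<in> space Y. \<exists>w. \<forall>n. map w [0..<n] \<in> T y}"
    by (rule analytic_set_tree) (rule that)
  (* The root is added so that the group is infinite even for the empty tree; this does not
     create branches. *)
  define T' where "T' y = insert [] (T y)" for y
  let ?G = "\<lambda>y. tree_group (doubled (T' y))"
  have pre': "prefix s t \<Longrightarrow> t \<in> T' y \<Longrightarrow> s \<in> T' y" for y s t
    using pre by (auto simp: T'_def)
  have branch: "has_branch (T' y) \<longleftrightarrow> (\<exists>w. \<forall>n. map w [0..<n] \<in> T y)" for y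
  proof
    assume "has_branch (T' y)"
    then obtain w where w: "\<And>n. map w [0..<n] \<in> T' y" by (auto simp: has_branch_def)
    have "map w [0..<Suc n] \<in> T y" for n
      using w[of "Suc n"] by (simp add: T'_def)
    moreover have "prefix (map w [0..<n]) (map w [0..<Suc n])" for n by simp
    ultimately have "map w [0..<n] \<in> T y" for n using pre by blast
    then show "\<exists>w. \<forall>n. map w [0..<n] \<in> T y" by blast
  qed (auto simp: has_branch_def T'_def)
  have hop: "hopfian (?G y) \<longleftrightarrow> \<not> has_branch (T' y)" for y
  proof
    assume "\<not> has_branch (T' y)"
    then show "hopfian (?G y)"
      using doubled_prefix_closed[of "T' y"] pre'
      by (intro hopfian_if_no_branch) (auto simp: has_branch_doubled_iff)
  next
    assume "hopfian (?G y)"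
    then show "\<not> has_branch (T' y)" using not_hopfian_if_branch unfolding has_branch_def by blast
  qed
  have meas: "{y \<in> space Y. c \<in> carrier (?G y)} \<in> sets Y" for c
  proof -
    have T': "{y \<in> space Y. s \<in> doubled (T' y)} \<in> sets Y" for s
      using T by (cases "s = []") (auto simp: doubled_def T'_def)
    show ?thesis
      unfolding carrier_tree_group tree_functions_def mem_Collect_eq
      by (intro sets.sets_Collect_conj sets.sets_Collect_countable_All sets.sets_Collect_imp
          sets.sets_Collect_const T')
  qed
  have sub: "carrier (?G y) \<subseteq> {f. finite {s. f s \<noteq> 0}}" for y
    by (auto simp: tree_functions_def)
  have mul: "mult (?G y) = (\<lambda>f g s. f s + g s)" for y
    by (simp add: tree_group_def)
  have inf: "infinite (carrier (?G y))" for y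
    by (simp add: infinite_tree_functions doubled_def T'_def)
  obtain f where f: "f \<in> measurable Y group_space"
    and iso: "\<And>y. y \<in> space Y \<Longrightarrow> \<exists>e. e \<in> iso (op_monoid (f y)) (?G y)"
    by (rule measurable_op_realization[OF countable_finite_support sub mul group_tree_group inf meas])
      (rule that)
  have "hopfian (op_monoid (f y)) \<longleftrightarrow> y \<in> B" if y: "y \<in> space Y" for y
  proof -
    have grp: "group (op_monoid (f y))"
      using measurable_space[OF f y] by (simp add: group_space_def space_restrict_space)
    obtain e where e: "e \<in> iso (op_monoid (f y)) (?G y)" using iso y by blast
    have "hopfian (op_monoid (f y)) \<longleftrightarrow> hopfian (?G y)"
      using hopfian_iso[OF grp _ e] hopfian_iso[OF group_tree_group _ group.iso_set_sym[OF grp e]] by blast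
    then show ?thesis using hop branch X y by blast
  qed
  moreover have "B \<subseteq> space Y" using B by (simp add: coanalytic_set_def)
  ultimately have "f -` hopfian_groups \<inter> space Y = B"
    using measurable_space[OF f] by (auto simp: hopfian_groups_def)
  with f show "\<exists>f \<in> measurable Y group_space. f -` hopfian_groups \<inter> space Y = B" by blast
qed

end
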